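(* For $p\ge1$ let $\kappa_p(x)=x(1-x)^p+(1-x)x^p$ for $x\in[0,1]$, and let $K_p=\sup_{x\in[0,1]}\kappa_p(x)$. Then: (i) For all real $a<A$, every random variable $X$ with support in $[a,A]$ and mean $\mu=\mathbf{E}[X]$, and every real $p\ge1$, $$\mathbf{E}\big[|X-\mu|^p\big]\le (A-a)^p\,\kappa_p\Big(\frac{\mu-a}{A-a}\Big),$$ and consequently $$\mathbf{E}\big[|X-\mu|^p\big]\le (A-a)^p K_p .$$ (ii) $(1+p)K_p\to e^{-1}$ as $p\to\infty$. (iii) For every $p\ge1$, the maximum $K_p$ of $\kappa_p$ is achieved at a unique point $x=x_p$ in the interval $[1/(1+p),1/2]$, and thus, by symmetry, also at the point $1-x_p$ in the interval $[1/2,p/(1+p)]$. (iv) $(1+p)x_p\to1$ as $p\to\infty$.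
   Context: "$X$ has support in $[a,A]$" means $X\in[a,A]$ almost surely. The parameter $p$ ranges over real numbers. *)

theory Defs
  imports "HOL-Probability.Probability"
begin

(* Only used for real p >= 1, where 0 powr p = 0 agrees with the usual power. *)
definition kappa :: "real \<Rightarrow> real \<Rightarrow> real" where
  "kappa p x = x * (1 - x) powr p + (1 - x) * x powr p"

definition K :: "real \<Rightarrow> real" where
  "K p = (SUP x\<in>{0..1}. kappa p x)"

(* The description is meaningful because the theorem asserts, for p >= 1, that exactly one
   point of the interval attains the supremum. *)
definition x_max :: "real \<Rightarrow> real" where
  "x_max p = (THE x. x \<in> {1 / (1 + p)..1 / 2} \<and> kappa p x = K p)"

end

(* Up to a positive factor the derivative of kappa at x is
   h(r) = (1 - p r) + r^(p-1) (p - r) with r = x/(1-x). It is positive for r <= 1/p, and on (1/p, 1)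
   it has the sign of the logarithm phi(r) = (p-1) ln r + ln (p-r) - ln (p r - 1) of the ratio of its
   two parts, while phi' has the sign of -(r^2 - (p-1) r + 1). So phi decreases, or decreases and
   then increases, towards phi(1) = 0; hence h changes sign at most once, from + to -, which gives
   the unique maximum. As h((1+e)/p) tends to -e, the maximum is at r ~ 1/p. The limit of K_p comes
   from x (1-x)^p, whose maximum is at 1/(1+p), the other term being at most 2^(-p) on [0,1/2].
   The moment bound holds because the convex function |t - mu|^p lies below its chord over [a,A]. *)

theory Submission
  imports Defs "HOL-Real_Asymp.Real_Asymp"
begin

section \<open>Elementary bounds, symmetry and continuity of \<open>kappa\<close>\<close>

lemma kappa_symmetric: "kappa p (1 - x) = kappa p x"
  by (simp add: kappa_def)

text \<open>A convex combination of two powers that are at most 1. The bound is crude, but it makes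
  the real supremum in \<open>K\<close> one over a bounded set, so that values of
  \<open>kappa\<close> can be compared with \<open>K\<close>.\<close>

lemma kappa_le_one:
  assumes "1 \<le> p" "x \<in> {0..1}"
  shows "kappa p x \<le> 1"
proof -
  have "x * (1 - x) powr p + (1 - x) * x powr p \<le> x * 1 + (1 - x) * 1"
    using assms by (intro add_mono mult_left_mono powr_le1) auto
  then show ?thesis by (simp add: kappa_def)
qed

lemma kappa_le_K:
  assumes "1 \<le> p" "x \<in> {0..1}"
  shows "kappa p x \<le> K p"
  unfolding K_def using assms
  by (intro cSUP_upper bdd_aboveI2[where M = 1]) (auto intro: kappa_le_one)

lemma continuous_on_kappa:
  assumes "1 \<le> p"
  shows "continuous_on {0..1} (kappa p)"
  unfolding kappa_def using assms
  by (intro continuous_intros continuous_on_powr') auto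

section \<open>Sign of the derivative of \<open>kappa\<close>\<close>

definition kappa_slope :: "real \<Rightarrow> real \<Rightarrow> real" where
  "kappa_slope p r = 1 - p * r + r powr (p - 1) * (p - r)"

text \<open>Lowering all exponents to p - 1 shows that, after division by (1 - x)^p, the derivative
  depends on x only through the odds x / (1 - x).\<close>

lemma kappa_has_derivative:
  assumes "0 < x" "x < 1"
  shows "(kappa p has_real_derivative (1 - x) powr p * kappa_slope p (x / (1 - x))) (at x)"
proof -
  have a: "(1 - x) powr p = (1 - x) * (1 - x) powr (p - 1)" "x powr p = x * x powr (p - 1)"
    using assms by (simp_all add: powr_diff)
  have b: "(x / (1 - x)) powr (p - 1) = x powr (p - 1) / (1 - x) powr (p - 1)"
    using assms by (simp add: powr_divide)
  have nz: "(1 - x) powr (p - 1) \<noteq> 0" "1 - x \<noteq> 0"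
    using assms by auto
  have "((\<lambda>x. x * (1 - x) powr p + (1 - x) * x powr p) has_real_derivative
     (1 - x) powr p - p * x * (1 - x) powr (p - 1) - x powr p + p * (1 - x) * x powr (p - 1)) (at x)"
    using assms by (auto intro!: derivative_eq_intros simp: algebra_simps)
  moreover have "(1 - x) powr p - p * x * (1 - x) powr (p - 1) - x powr p + p * (1 - x) * x powr (p - 1)
     = (1 - x) powr p * kappa_slope p (x / (1 - x))"
    unfolding kappa_slope_def b a using nz by (simp add: divide_simps) (simp add: algebra_simps)
  ultimately show ?thesis
    by (simp add: kappa_def[abs_def])
qed

text \<open>Here 1 - p r is nonnegative, and the other term is positive because r \<le> 1/p < p.
  This range is kept apart since the term ln (p r - 1) of \<open>log_slope\<close> calls for r >
  1/p.\<close>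

lemma kappa_slope_pos_left:
  assumes "1 < p" "0 < r" "r \<le> 1 / p"
  shows "kappa_slope p r > 0"
proof -
  have "p * r \<le> 1" using assms by (simp add: field_simps)
  moreover have "r < p"
    using assms by (smt (verit) divide_less_eq_1_pos)
  then have "r powr (p - 1) * (p - r) > 0" using assms by simp
  ultimately show ?thesis unfolding kappa_slope_def by linarith
qed

definition log_slope :: "real \<Rightarrow> real \<Rightarrow> real" where
  "log_slope p r = (p - 1) * ln r + ln (p - r) - ln (p * r - 1)"

lemma log_slope_sgn:
  assumes "1 < p" "1 / p < r" "r \<le> 1"
  shows "kappa_slope p r > 0 \<longleftrightarrow> log_slope p r > 0" "kappa_slope p r < 0 \<longleftrightarrow> log_slope p r < 0"
proof -
  have r: "0 < r" using assms by (smt (verit) divide_pos_pos)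
  have pr: "0 < p * r - 1" using assms by (simp add: field_simps)
  have "log_slope p r = ln (r powr (p - 1) * (p - r)) - ln (p * r - 1)"
    using r assms by (simp add: log_slope_def ln_mult ln_powr)
  moreover have "0 < r powr (p - 1) * (p - r)" using r assms by simp
  ultimately show "kappa_slope p r > 0 \<longleftrightarrow> log_slope p r > 0" "kappa_slope p r < 0 \<longleftrightarrow> log_slope p r < 0"
    using pr unfolding kappa_slope_def
    by (smt (verit) ln_less_cancel_iff)+
qed

text \<open>Over a common denominator the factor p (p - 1) comes out of the numerator. All remaining
  factors but the quadratic are positive, so the quadratic alone decides the sign.\<close>

lemma log_slope_has_derivative:
  assumes "1 < p" "1 / p < r" "r \<le> 1"
  shows "(log_slope p has_real_derivative
    - (p * (p - 1) * (r\<^sup>2 - (p - 1) * r + 1) / (r * (p - r) * (p * r - 1)))) (at r)"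
proof -
  have r: "0 < r" using assms by (smt (verit) divide_pos_pos)
  have pr: "0 < p * r - 1" using assms by (simp add: field_simps)
  have rp: "0 < p - r" using assms by simp
  have "((\<lambda>r. (p - 1) * ln r + ln (p - r) - ln (p * r - 1)) has_real_derivative
     (p - 1) / r - 1 / (p - r) - p / (p * r - 1)) (at r)"
    using r pr rp by (auto intro!: derivative_eq_intros)
  moreover have "(p - 1) / r - 1 / (p - r) - p / (p * r - 1)
    = - (p * (p - 1) * (r\<^sup>2 - (p - 1) * r + 1) / (r * (p - r) * (p * r - 1)))"
    using r pr rp by (simp add: divide_simps) (simp add: algebra_simps power2_eq_square)
  ultimately show ?thesis
    by (simp add: log_slope_def[abs_def])
qed

text \<open>Positivity is asked only strictly between r and s, so that an endpoint may be a root of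
  the quadratic. This happens at s = 1 when p = 3.\<close>

lemma log_slope_decreasing:
  assumes "1 < p" "1 / p < r" "r < s" "s \<le> 1"
    and q: "\<And>t. r < t \<Longrightarrow> t < s \<Longrightarrow> t\<^sup>2 - (p - 1) * t + 1 > 0"
  shows "log_slope p s < log_slope p r"
proof (rule DERIV_neg_imp_decreasing_open[OF \<open>r < s\<close>])
  fix t assume t: "r < t" "t < s"
  have "t \<le> 1" using assms t by linarith
  have "0 < t" using assms t by (smt (verit) divide_pos_pos)
  moreover have "1 / p < t" using assms t by linarith
  moreover from this have "0 < p * t - 1" using assms by (simp add: field_simps)
  ultimately have "- (p * (p - 1) * (t\<^sup>2 - (p - 1) * t + 1) / (t * (p - t) * (p * t - 1))) < 0"
    using assms t q[OF t] by simp
  then show "\<exists>y. (log_slope p has_real_derivative y) (at t) \<and> y < 0"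
    using log_slope_has_derivative[OF \<open>1 < p\<close> \<open>1 / p < t\<close> \<open>t \<le> 1\<close>] by blast
next
  show "continuous_on {r..s} (log_slope p)"
    using assms
    by (intro continuous_at_imp_continuous_on ballI DERIV_isCont[OF log_slope_has_derivative]) auto
qed

lemma log_slope_increasing:
  assumes "1 < p" "1 / p < r" "r < s" "s \<le> 1"
    and q: "\<And>t. r < t \<Longrightarrow> t < s \<Longrightarrow> t\<^sup>2 - (p - 1) * t + 1 < 0"
  shows "log_slope p r < log_slope p s"
proof (rule DERIV_pos_imp_increasing_open[OF \<open>r < s\<close>])
  fix t assume t: "r < t" "t < s"
  have "t \<le> 1" using assms t by linarith
  have "0 < t" using assms t by (smt (verit) divide_pos_pos)
  moreover have "1 / p < t" using assms t by linarith
  moreover from this have "0 < p * t - 1" using assms by (simp add: field_simps)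
  ultimately have "- (p * (p - 1) * (t\<^sup>2 - (p - 1) * t + 1) / (t * (p - t) * (p * t - 1))) > 0"
    using assms t q[OF t] by (simp add: divide_less_0_iff mult_less_0_iff zero_less_mult_iff)
  then show "\<exists>y. (log_slope p has_real_derivative y) (at t) \<and> y > 0"
    using log_slope_has_derivative[OF \<open>1 < p\<close> \<open>1 / p < t\<close> \<open>t \<le> 1\<close>] by blast
next
  show "continuous_on {r..s} (log_slope p)"
    using assms
    by (intro continuous_at_imp_continuous_on ballI DERIV_isCont[OF log_slope_has_derivative]) auto
qed

lemma log_slope_1 [simp]: "log_slope p 1 = 0"
  by (simp add: log_slope_def)

text \<open>The quadratic t^2 - (p - 1) t + 1 equals 3 - p at t = 1, so it has a root inside (0, 1)
  only for p > 3. For p \<le> 3 the slope stays positive up to 1, so c = 1 works and the last claim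
  is vacuous; for p > 3 the sign really changes, at some c < 1.\<close>

lemma kappa_slope_sign_change:
  assumes "1 \<le> p"
  obtains c where "c \<in> {1 / p..1}" "\<And>r. 0 < r \<Longrightarrow> r < c \<Longrightarrow> kappa_slope p r > 0"
    "\<And>r. c < r \<Longrightarrow> r < 1 \<Longrightarrow> kappa_slope p r < 0"
proof -
  consider "p = 1" | "1 < p" "p \<le> 3" | "3 < p" using assms by linarith
  then show thesis
  proof cases
    case 1
    \<comment> \<open>For p = 1 and r > 0 the slope is 2 (1 - r).\<close>
    show thesis
      by (rule that[of 1]) (auto simp: 1 kappa_slope_def)
  next
    case 2
    have "kappa_slope p r > 0" if r: "0 < r" "r < 1" for r
    proof (cases "r \<le> 1 / p")
      case True
      then show ?thesis using kappa_slope_pos_left 2 r by blast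
    next
      case False
      have "t\<^sup>2 - (p - 1) * t + 1 > 0" if "r < t" "t < 1" for t
      proof -
        have "(p - 1) * t \<le> 2 * t" using 2 r that by (intro mult_right_mono) auto
        moreover have "(1 - t)\<^sup>2 > 0" using that by simp
        ultimately show ?thesis by (simp add: power2_eq_square algebra_simps)
      qed
      then have "log_slope p 1 < log_slope p r"
        using False 2 r by (intro log_slope_decreasing) auto
      then show ?thesis using log_slope_sgn(1)[of p r] False 2 r by simp
    qed
    then show thesis using 2 by (intro that[of 1]) auto
  next
    case 3
    define q where "q = (\<lambda>t. t\<^sup>2 - (p - 1) * t + 1)"
    \<comment> \<open>The two values are 1/p + 1/p^2 and 3 - p.\<close>
    have "0 < q (1 / p)" using 3 by (simp add: q_def field_simps power2_eq_square)
    moreover have "q 1 < 0" using 3 by (simp add: q_def)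
    moreover have "continuous_on {1 / p..1} q"
      unfolding q_def by (intro continuous_intros)
    ultimately obtain s where s0: "1 / p \<le> s" "s \<le> 1" "q s = 0"
      using IVT2'[of q 1 0 "1 / p"] 3 by auto
    have s: "1 / p < s" "s < 1"
      using s0 \<open>0 < q (1 / p)\<close> \<open>q 1 < 0\<close> by (metis order_le_less less_irrefl)+
    \<comment> \<open>The roots of \<open>q\<close> sum to p - 1 > 2, so the other root lies beyond
      1. Below 1 the second factor is therefore negative, and \<open>q\<close> changes sign only at
      s.\<close>
    have fac: "q t = (t - s) * (t + s - (p - 1))" for t
      using s0(3) by (simp add: q_def power2_eq_square algebra_simps)
    have qpos: "q t > 0" if "t < s" for t
      unfolding fac using that s 3 by (intro mult_neg_neg) auto
    have qneg: "q t < 0" if "s < t" "t < 1" for t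
      unfolding fac using that s 3 by (intro mult_pos_neg) auto
    have right: "log_slope p r < 0" if "s \<le> r" "r < 1" for r
      using log_slope_increasing[of p r 1] that s 3 qneg by (auto simp: q_def)
    \<comment> \<open>The zero c is sought for \<open>kappa_slope\<close> and not for
      \<open>log_slope\<close>, because the latter tends to infinity at 1/p.\<close>
    have "kappa_slope p s < 0"
      using right[of s] s 3 log_slope_sgn(2)[of p s] by simp
    moreover have "kappa_slope p (1 / p) > 0" using 3 by (intro kappa_slope_pos_left) auto
    moreover have "continuous_on {1 / p..s} (kappa_slope p)"
      unfolding kappa_slope_def using 3 by (intro continuous_intros) (auto simp: not_le)
    ultimately obtain c where c: "1 / p \<le> c" "c \<le> s" "kappa_slope p c = 0"
      using IVT2'[of "kappa_slope p" s 0 "1 / p"] s by auto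
    have c': "1 / p < c"
      using c \<open>kappa_slope p (1 / p) > 0\<close> by (metis order_le_less less_irrefl)
    have lc: "log_slope p c = 0"
      using log_slope_sgn[of p c] c c' s 3 by auto
    show thesis
    proof (rule that[of c])
      show "c \<in> {1 / p..1}" using c s by auto
    next
      fix r assume r: "0 < r" "r < c"
      show "kappa_slope p r > 0"
      proof (cases "r \<le> 1 / p")
        case True
        then show ?thesis using kappa_slope_pos_left 3 r by simp
      next
        case False
        then have "log_slope p c < log_slope p r"
          using 3 r c s qpos by (intro log_slope_decreasing) (auto simp: q_def)
        then show ?thesis using log_slope_sgn(1)[of p r] False 3 r c s lc by simp
      qed
    next
      fix r assume r: "c < r" "r < 1"
      have "log_slope p r < 0"
      proof (cases "s \<le> r")
        case True
        then show ?thesis using right r by simp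
      next
        case False
        then have "log_slope p r < log_slope p c"
          using 3 r c' s qpos by (intro log_slope_decreasing) (auto simp: q_def)
        then show ?thesis using lc by simp
      qed
      then show "kappa_slope p r < 0" using log_slope_sgn(2)[of p r] r c' 3 by simp
    qed
  qed
qed

section \<open>Location and uniqueness of the maximum\<close>

text \<open>The odds x / (1 - x) increase with x and have the inverse c / (1 + c), which carries
  [1/p, 1] onto [1/(1+p), 1/2]. The sign change thus makes \<open>kappa\<close> rise strictly up to
  m and fall strictly from there to 1/2. The sign left of m is recorded because it later bounds the
  maximiser from above.\<close>

lemma kappa_maximum:
  assumes p: "1 \<le> p"
  obtains m where "m \<in> {1 / (1 + p)..1 / 2}"
    "\<And>x. 0 < x \<Longrightarrow> x < m \<Longrightarrow> kappa_slope p (x / (1 - x)) > 0"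
    "\<And>x. x \<in> {0..1 / 2} \<Longrightarrow> x \<noteq> m \<Longrightarrow> kappa p x < kappa p m"
proof -
  obtain c where c: "c \<in> {1 / p..1}" and pos: "\<And>r. 0 < r \<Longrightarrow> r < c \<Longrightarrow> kappa_slope p r > 0"
    and neg: "\<And>r. c < r \<Longrightarrow> r < 1 \<Longrightarrow> kappa_slope p r < 0"
    using kappa_slope_sign_change[OF p] by blast
  have c0: "0 < c" using c p by (smt (verit) atLeastAtMost_iff divide_pos_pos)
  have c1: "c \<le> 1" "1 \<le> c * p" using c p by (auto simp: field_simps)
  define m where "m = c / (1 + c)"
  have m: "m \<in> {1 / (1 + p)..1 / 2}"
    using c0 c1 p by (auto simp: m_def field_simps)
  have m0: "0 < m" using c0 by (simp add: m_def)
  have lt: "x / (1 - x) < c \<longleftrightarrow> x < m" "c < x / (1 - x) \<longleftrightarrow> m < x" if "x < 1" for x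
    using that c0 by (auto simp: m_def field_simps)
  have pos': "kappa_slope p (x / (1 - x)) > 0" if "0 < x" "x < m" for x
    using that m lt[of x] by (intro pos) auto
  have neg': "kappa_slope p (x / (1 - x)) < 0" if "m < x" "x < 1 / 2" for x
    using that m lt[of x] by (intro neg) (auto simp: field_simps)
  show thesis
  proof (rule that[OF m pos'])
    fix x assume x: "x \<in> {0..1 / 2}" "x \<noteq> m"
    show "kappa p x < kappa p m"
    proof (cases "x < m")
      case True
      then show ?thesis
      proof (rule DERIV_pos_imp_increasing_open)
        fix t assume t: "x < t" "t < m"
        have "0 < t" "t < 1" using t x m m0 by auto
        then have "(1 - t) powr p * kappa_slope p (t / (1 - t)) > 0"
          using t pos'[of t] by auto
        then show "\<exists>y. (kappa p has_real_derivative y) (at t) \<and> y > 0"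
          using kappa_has_derivative[OF \<open>0 < t\<close> \<open>t < 1\<close>] by blast
      next
        show "continuous_on {x..m} (kappa p)"
          using x m by (intro continuous_on_subset[OF continuous_on_kappa[OF p]]) auto
      qed
    next
      case False
      then have "m < x" using x by simp
      then show ?thesis
      proof (rule DERIV_neg_imp_decreasing_open)
        fix t assume t: "m < t" "t < x"
        have "0 < t" "t < 1" using t x m m0 by auto
        then have "(1 - t) powr p * kappa_slope p (t / (1 - t)) < 0"
          using t x neg'[of t] by (auto simp: mult_less_0_iff)
        then show "\<exists>y. (kappa p has_real_derivative y) (at t) \<and> y < 0"
          using kappa_has_derivative[OF \<open>0 < t\<close> \<open>t < 1\<close>] by blast
      next
        show "continuous_on {m..x} (kappa p)"
          using x m0 by (intro continuous_on_subset[OF continuous_on_kappa[OF p]]) auto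
      qed
    qed
  qed auto
qed

text \<open>The symmetry x -> 1 - x turns the maximum over [0, 1/2] into the maximum over [0, 1], so
  the supremum is attained at m. Strictness on the half interval gives uniqueness, which identifies
  the described point \<open>x_max p\<close> with m.\<close>

lemma x_max_properties:
  assumes p: "1 \<le> p"
  shows "x_max p \<in> {1 / (1 + p)..1 / 2}" (is ?in)
    and "kappa p (x_max p) = K p" (is ?eq)
    and "\<exists>!x. x \<in> {1 / (1 + p)..1 / 2} \<and> kappa p x = K p" (is ?ex1)
    and "\<And>x. 0 < x \<Longrightarrow> x < x_max p \<Longrightarrow> kappa_slope p (x / (1 - x)) > 0"
proof -
  obtain m where m: "m \<in> {1 / (1 + p)..1 / 2}"
    and pos: "\<And>x. 0 < x \<Longrightarrow> x < m \<Longrightarrow> kappa_slope p (x / (1 - x)) > 0"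
    and max: "\<And>x. x \<in> {0..1 / 2} \<Longrightarrow> x \<noteq> m \<Longrightarrow> kappa p x < kappa p m"
    using kappa_maximum[OF p] by blast
  have i: "m \<in> {0..1}" using m p order_trans[of 0 "1 / (1 + p)" m] by auto
  have half: "kappa p x \<le> kappa p m" if "x \<in> {0..1 / 2}" for x
    using max[OF that] by (cases "x = m") auto
  have "kappa p x \<le> kappa p m" if "x \<in> {0..1}" for x
    using that half[of x] half[of "1 - x"] kappa_symmetric[of p x] by (cases "x \<le> 1 / 2") auto
  then have K: "K p = kappa p m"
    unfolding K_def using i by (intro cSup_eq_maximum imageI) auto
  have uniq: "x = m" if "x \<in> {1 / (1 + p)..1 / 2} \<and> kappa p x = K p" for x
    using max[of x] that K p order_trans[of 0 "1 / (1 + p)" x] by auto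
  then have eq: "x_max p = m"
    unfolding x_max_def using m K by (intro the_equality) auto
  show ?in ?eq using m K by (simp_all add: eq)
  show ?ex1 using m K uniq by metis
  show "kappa_slope p (x / (1 - x)) > 0" if "0 < x" "x < x_max p" for x
    using pos that by (simp add: eq)
qed

section \<open>Asymptotics of the maximiser\<close>

lemma x_max_asymptotics: "((\<lambda>p. (1 + p) * x_max p) \<longlongrightarrow> 1) at_top"
proof (rule order_tendstoI)
  fix a :: real assume "a < 1"
  moreover have "eventually (\<lambda>p. 1 \<le> (1 + p) * x_max p) at_top"
    using eventually_ge_at_top[of 1]
  proof eventually_elim
    case (elim p)
    then show ?case using x_max_properties(1)[of p] by (simp add: field_simps)
  qed
  ultimately show "eventually (\<lambda>p. a < (1 + p) * x_max p) at_top"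
    by (auto elim: eventually_mono)
next
  fix a :: real assume a: "1 < a"
  \<comment> \<open>Half of the gap, so that the limit 1 + e obtained below stays strictly under
    a.\<close>
  define e where "e = (a - 1) / 2"
  have e: "0 < e" "1 + e < a" using a by (simp_all add: e_def field_simps)
  have "((\<lambda>p. kappa_slope p ((1 + e) / p)) \<longlongrightarrow> - e) at_top"
    unfolding kappa_slope_def using e(1) by real_asymp
  then have "eventually (\<lambda>p. kappa_slope p ((1 + e) / p) < 0) at_top"
    using e by (intro order_tendstoD(2)) auto
  moreover have "((\<lambda>p. (1 + p) * ((1 + e) / (p + (1 + e)))) \<longlongrightarrow> 1 + e) at_top"
    using e(1) by real_asymp
  then have "eventually (\<lambda>p. (1 + p) * ((1 + e) / (p + (1 + e))) < a) at_top"
    using e by (intro order_tendstoD(2)) auto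
  ultimately show "eventually (\<lambda>p. (1 + p) * x_max p < a) at_top"
    using eventually_ge_at_top[of 1]
  proof eventually_elim
    case (elim p)
    \<comment> \<open>The point whose odds are (1 + e) / p.\<close>
    define y where "y = (1 + e) / (p + (1 + e))"
    have "1 - y = p / (p + (1 + e))" "0 < y"
      using elim e by (auto simp: y_def field_simps)
    then have "y / (1 - y) = (1 + e) / p" "0 < y"
      using elim e by (auto simp: y_def)
    \<comment> \<open>The slope is positive everywhere left of \<open>x_max p\<close> but negative
      at y.\<close>
    then have "x_max p \<le> y"
      using x_max_properties(4)[of p y] elim by (smt (verit))
    then have "(1 + p) * x_max p \<le> (1 + p) * y"
      using elim by (intro mult_left_mono) auto
    then show ?case using elim by (simp add: y_def)
  qed
qed

section \<open>Asymptotics of the supremum\<close>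

text \<open>This is weighted AM-GM: the numbers (1 + p) x and (1 + p)(1 - x) / p, with weights 1 and
  p, have weighted mean 1. In logarithmic form, the bounds ln u \<le> u - 1 add up to 0.\<close>

lemma mult_powr_one_minus_le:
  fixes x p :: real
  assumes p: "1 \<le> p" and x: "0 < x" "x < 1"
  shows "(1 + p) * (x * (1 - x) powr p) \<le> (p / (1 + p)) powr p"
proof -
  have "ln ((1 + p) * x) + p * ln ((1 + p) * (1 - x) / p)
      \<le> ((1 + p) * x - 1) + p * ((1 + p) * (1 - x) / p - 1)"
    using p x by (intro add_mono mult_left_mono ln_le_minus_one) auto
  also have "\<dots> = 0" using p by (simp add: field_simps)
  finally have "ln ((1 + p) * x) + p * ln ((1 + p) * (1 - x) / p) \<le> 0" .
  moreover have "ln ((1 + p) * (1 - x) / p) = ln (1 - x) - ln (p / (1 + p))"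
    using p x by (simp add: ln_mult ln_div)
  ultimately have "ln ((1 + p) * x) + p * ln (1 - x) \<le> p * ln (p / (1 + p))"
    by (simp add: right_diff_distrib)
  then have "ln ((1 + p) * x * (1 - x) powr p) \<le> ln ((p / (1 + p)) powr p)"
    using p x by (simp add: ln_mult[of "(1 + p) * x"] ln_powr)
  then have "(1 + p) * x * (1 - x) powr p \<le> (p / (1 + p)) powr p"
    using p x by (subst (asm) ln_le_cancel_iff) auto
  then show ?thesis by (simp add: mult.assoc)
qed

lemma K_asymptotics: "((\<lambda>p. (1 + p) * K p) \<longlongrightarrow> exp (- 1)) at_top"
proof (rule tendsto_sandwich)
  show "((\<lambda>p :: real. (p / (1 + p)) powr p) \<longlongrightarrow> exp (- 1)) at_top"
    by real_asymp
  show "((\<lambda>p :: real. (p / (1 + p)) powr p + (1 + p) * (1 / 2) powr p) \<longlongrightarrow> exp (- 1)) at_top"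
    by real_asymp
  show "eventually (\<lambda>p. (p / (1 + p)) powr p \<le> (1 + p) * K p) at_top"
    using eventually_ge_at_top[of 1]
  proof eventually_elim
    case (elim p)
    have e: "1 - 1 / (1 + p) = p / (1 + p)" using elim by (simp add: field_simps)
    \<comment> \<open>The point 1/(1+p) maximises the first summand of \<open>kappa\<close>; the
      second one is nonnegative and is dropped.\<close>
    have "1 / (1 + p) * (p / (1 + p)) powr p \<le> kappa p (1 / (1 + p))"
      using elim unfolding kappa_def e by simp
    also have "\<dots> \<le> K p" using elim by (intro kappa_le_K) auto
    finally show ?case using elim by (simp add: field_simps)
  qed
  show "eventually (\<lambda>p. (1 + p) * K p \<le> (p / (1 + p)) powr p + (1 + p) * (1 / 2) powr p) at_top"
    using eventually_ge_at_top[of 1]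
  proof eventually_elim
    case (elim p)
    define x where "x = x_max p"
    have "0 < 1 / (1 + p)" using elim by simp
    then have x: "0 < x" "x \<le> 1 / 2"
      using x_max_properties(1)[OF elim] unfolding x_def by (metis atLeastAtMost_iff less_le_trans)+
    \<comment> \<open>Since the maximiser is at most 1/2, the second summand decays exponentially
      and vanishes in the limit even after multiplication by 1 + p.\<close>
    have "(1 - x) * x powr p \<le> 1 * (1 / 2) powr p"
      using x elim by (intro mult_mono powr_mono2) auto
    then have "(1 + p) * ((1 - x) * x powr p) \<le> (1 + p) * (1 / 2) powr p"
      using elim by (intro mult_left_mono) auto
    moreover have "K p = kappa p x" using x_max_properties(2)[OF elim] by (simp add: x_def)
    ultimately show ?case
      using mult_powr_one_minus_le[OF elim, of x] x by (simp add: kappa_def distrib_left)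
  qed
qed

section \<open>The moment bound\<close>

lemma convex_on_powr_nonneg:
  fixes p :: real
  assumes "1 \<le> p"
  shows "convex_on {0..} (\<lambda>x. x powr p)"
proof (rule convex_onI)
  \<comment> \<open>For nonzero x and y convexity is \<open>powr_convex\<close>. If one of them is
    0, it reduces to this inequality, which rests on t^p \<le> t for t in (0, 1).\<close>
  have scale: "(t * x) powr p \<le> t * x powr p" if "0 \<le> x" "0 < t" "t < 1" for t x :: real
    using that assms by (auto simp: powr_mult powr_le_one_le intro!: mult_right_mono)
  fix t x y :: real
  assume "0 < t" "t < 1" "x \<in> {0..}" "y \<in> {0..}"
  then show "((1 - t) *\<^sub>R x + t *\<^sub>R y) powr p \<le> (1 - t) * x powr p + t * y powr p"
    using scale[of y t] scale[of x "1 - t"] convex_onD[OF powr_convex[OF assms], of t x y]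
    by (cases "x = 0"; cases "y = 0") auto
qed simp

text \<open>With t = (1 - l) a + l A, the triangle inequality bounds the distance to \<mu> by a
  convex combination of \<mu> - a and A - \<mu>, and convexity of the power finishes. The bound is
  affine in t, so its expectation depends only on the mean of t.\<close>

lemma abs_powr_le_chord:
  fixes a A \<mu> t p :: real
  assumes "a < A" "t \<in> {a..A}" "\<mu> \<in> {a..A}" "1 \<le> p"
  shows "\<bar>t - \<mu>\<bar> powr p \<le> ((A - t) * (\<mu> - a) powr p + (t - a) * (A - \<mu>) powr p) / (A - a)"
proof -
  define l where "l = (t - a) / (A - a)"
  have l: "0 \<le> l" "l \<le> 1" "1 - l = (A - t) / (A - a)"
    using assms by (auto simp: l_def field_simps)
  have "l * (A - a) = t - a" using assms by (simp add: l_def)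
  then have "t - \<mu> = (1 - l) * (a - \<mu>) + l * (A - \<mu>)" by (simp add: algebra_simps)
  also have "\<bar>\<dots>\<bar> \<le> \<bar>(1 - l) * (a - \<mu>)\<bar> + \<bar>l * (A - \<mu>)\<bar>" by (rule abs_triangle_ineq)
  also have "\<dots> = (1 - l) * (\<mu> - a) + l * (A - \<mu>)"
    using assms l by (simp add: abs_mult)
  finally have "\<bar>t - \<mu>\<bar> powr p \<le> ((1 - l) * (\<mu> - a) + l * (A - \<mu>)) powr p"
    using assms by (intro powr_mono2) auto
  also have "\<dots> \<le> (1 - l) * (\<mu> - a) powr p + l * (A - \<mu>) powr p"
    using convex_onD[OF convex_on_powr_nonneg[OF \<open>1 \<le> p\<close>], of l "\<mu> - a" "A - \<mu>"] assms l by simp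
  also have "\<dots> = ((A - t) * (\<mu> - a) powr p + (t - a) * (A - \<mu>) powr p) / (A - a)"
    unfolding l(3) by (simp add: l_def add_divide_distrib)
  finally show ?thesis .
qed

lemma (in prob_space) expectation_abs_powr_le_kappa:
  fixes X :: "'a \<Rightarrow> real"
  assumes X [measurable]: "X \<in> borel_measurable M" and aA: "a < A"
    and supp: "AE \<omega> in M. X \<omega> \<in> {a..A}" and p: "1 \<le> p"
  defines "\<mu> \<equiv> expectation X"
  shows "\<mu> \<in> {a..A}" (is ?in)
    and "expectation (\<lambda>\<omega>. \<bar>X \<omega> - \<mu>\<bar> powr p) \<le> (A - a) powr p * kappa p ((\<mu> - a) / (A - a))"
      (is ?le)
proof -
  have int: "integrable M X"
    by (rule integrable_const_bound[where B = "\<bar>a\<bar> + \<bar>A\<bar>"]) (use supp in auto)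
  have "a \<le> \<mu>" unfolding \<mu>_def using int supp by (intro integral_ge_const) auto
  moreover have "\<mu> \<le> A" unfolding \<mu>_def using int supp by (intro integral_le_const) auto
  ultimately show mu: ?in by simp
  define g where "g = (\<lambda>\<omega>. ((A - X \<omega>) * (\<mu> - a) powr p + (X \<omega> - a) * (A - \<mu>) powr p) / (A - a))"
  have chord: "AE \<omega> in M. \<bar>X \<omega> - \<mu>\<bar> powr p \<le> g \<omega>"
    using supp by eventually_elim (use abs_powr_le_chord aA mu p in \<open>simp add: g_def\<close>)
  have gint: "integrable M g" unfolding g_def using int by simp
  have "integrable M (\<lambda>\<omega>. \<bar>X \<omega> - \<mu>\<bar> powr p)"
    by (rule Bochner_Integration.integrable_bound[OF gint]) (use chord in auto)
  then have "expectation (\<lambda>\<omega>. \<bar>X \<omega> - \<mu>\<bar> powr p) \<le> expectation g"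
    using chord gint by (intro integral_mono_AE)
  \<comment> \<open>As \<open>g\<close> is affine in X, integration amounts to replacing X by its
    mean.\<close>
  also have "expectation g = ((A - \<mu>) * (\<mu> - a) powr p + (\<mu> - a) * (A - \<mu>) powr p) / (A - a)"
    unfolding g_def using int by (simp add: \<mu>_def prob_space)
  \<comment> \<open>Homogeneity: \<mu> - a and A - \<mu> are A - a times the two weights in
    \<open>kappa\<close>.\<close>
  also have "\<dots> = (A - a) powr p * kappa p ((\<mu> - a) / (A - a))"
  proof -
    have "1 - (\<mu> - a) / (A - a) = (A - \<mu>) / (A - a)" using aA by (simp add: field_simps)
    then show ?thesis using aA mu by (simp add: kappa_def powr_divide distrib_left add_divide_distrib)
  qed
  finally show ?le .
qed

theorem theorem6p1:
  shows "(\<forall>(M :: 'a measure) (X :: 'a \<Rightarrow> real) (a :: real) (A :: real) (\<mu> :: real) (p :: real).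
            prob_space M \<longrightarrow> X \<in> borel_measurable M \<longrightarrow> a < A \<longrightarrow>
            (AE \<omega> in M. X \<omega> \<in> {a..A}) \<longrightarrow> \<mu> = prob_space.expectation M X \<longrightarrow> 1 \<le> p \<longrightarrow>
              prob_space.expectation M (\<lambda>\<omega>. \<bar>X \<omega> - \<mu>\<bar> powr p)
                \<le> (A - a) powr p * kappa p ((\<mu> - a) / (A - a)) \<and>
              prob_space.expectation M (\<lambda>\<omega>. \<bar>X \<omega> - \<mu>\<bar> powr p) \<le> (A - a) powr p * K p)
    \<and> ((\<lambda>p. (1 + p) * K p) \<longlongrightarrow> exp (- 1)) at_top
    \<and> (\<forall>p\<ge>1. (\<exists>!x. x \<in> {1 / (1 + p)..1 / 2} \<and> kappa p x = K p)
            \<and> 1 - x_max p \<in> {1 / 2..p / (1 + p)} \<and> kappa p (1 - x_max p) = K p)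
    \<and> ((\<lambda>p. (1 + p) * x_max p) \<longlongrightarrow> 1) at_top"
proof (intro conjI allI impI)
  fix M :: "'a measure" and X :: "'a \<Rightarrow> real" and a A \<mu> p :: real
  assume M: "prob_space M" and X: "X \<in> borel_measurable M" "a < A" "AE \<omega> in M. X \<omega> \<in> {a..A}"
    and \<mu>: "\<mu> = prob_space.expectation M X" and p: "1 \<le> p"
  note * = prob_space.expectation_abs_powr_le_kappa[OF M X p, folded \<mu>]
  show le: "prob_space.expectation M (\<lambda>\<omega>. \<bar>X \<omega> - \<mu>\<bar> powr p)
      \<le> (A - a) powr p * kappa p ((\<mu> - a) / (A - a))"
    by (rule *(2))
  \<comment> \<open>Because \<mu> lies in [a, A], the argument of \<open>kappa\<close> lies in
    [0, 1].\<close>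
  also have "\<dots> \<le> (A - a) powr p * K p"
    using *(1) X(2) p by (intro mult_left_mono kappa_le_K) auto
  finally show "prob_space.expectation M (\<lambda>\<omega>. \<bar>X \<omega> - \<mu>\<bar> powr p) \<le> (A - a) powr p * K p" .
next
  fix p :: real assume p: "1 \<le> p"
  show "\<exists>!x. x \<in> {1 / (1 + p)..1 / 2} \<and> kappa p x = K p" by (rule x_max_properties(3)[OF p])
  have "p / (1 + p) = 1 - 1 / (1 + p)" using p by (simp add: field_simps)
  then show "1 - x_max p \<in> {1 / 2..p / (1 + p)}" using x_max_properties(1)[OF p] by auto
  show "kappa p (1 - x_max p) = K p" using x_max_properties(2)[OF p] by (simp add: kappa_symmetric)
qed (rule K_asymptotics x_max_asymptotics)+

end
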